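(* Let $G$ be a finite simple graph whose only cycle is a triangle $C_3$ (i.e., $G$ contains exactly one cycle, and it has length $3$). Then the family $\Psi(G)$ of local maximum stable sets of $G$ is a greedoid on $V(G)$.
   Context: All graphs are finite, simple (undirected, no loops, no multiple edges). For $A\subseteq V(G)$, $N(A)=\{v\in V(G)-A: v \text{ has a neighbor in } A\}$ and $N[A]=A\cup N(A)$; $G[X]$ denotes the subgraph induced by $X$. A stable set is a set of pairwise non-adjacent vertices; $\Omega(H)$ denotes the family of all maximum-cardinality stable sets of a graph $H$. A set $A\subseteq V(G)$ is a local maximum stable set of $G$ if $A\in\Omega(G[N[A]])$; $\Psi(G)$ is the family of all local maximum stable sets of $G$. A greedoid on a finite set $V$ is a pair $(V,\mathcal{F})$ with $\emptyset\neq\mathcal{F}\subseteq 2^V$ satisfying (accessibility) every non-empty $X\in\mathcal{F}$ contains some $x$ with $X-\{x\}\in\mathcal{F}$, and (exchange) for $X,Y\in\mathcal{F}$ with $|X|=|Y|+1$ there is $x\in X-Y$ with $Y\cup\{x\}\in\mathcal{F}$. *)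

theory Defs
  imports "Graph_Theory.Arc_Walk" "Graph_Theory.Digraph_Component"
begin

text \<open>
  Finite simple graphs are those satisfying the locale predicate \<^term>\<open>graph\<close>: finite, symmetric,
  loop-free digraphs without parallel arcs. An undirected edge is a pair of opposite arcs.
\<close>

definition open_nbhd :: "('a, 'b) pre_digraph \<Rightarrow> 'a set \<Rightarrow> 'a set" where
  "open_nbhd G A = {v \<in> verts G - A. \<exists>a\<in>A. v \<rightarrow>\<^bsub>G\<^esub> a}"

definition closed_nbhd :: "('a, 'b) pre_digraph \<Rightarrow> 'a set \<Rightarrow> 'a set" where
  "closed_nbhd G A = A \<union> open_nbhd G A"

definition stable_set :: "('a, 'b) pre_digraph \<Rightarrow> 'a set \<Rightarrow> bool" where
  "stable_set G S \<longleftrightarrow> S \<subseteq> verts G \<and> (\<forall>u\<in>S. \<forall>v\<in>S. \<not> u \<rightarrow>\<^bsub>G\<^esub> v)"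

definition max_stable_sets :: "('a, 'b) pre_digraph \<Rightarrow> 'a set set" where
  "max_stable_sets G = {S. stable_set G S \<and> (\<forall>T. stable_set G T \<longrightarrow> card T \<le> card S)}"

definition local_max_stable_sets :: "('a, 'b) pre_digraph \<Rightarrow> 'a set set" where
  "local_max_stable_sets G =
     {A. A \<subseteq> verts G \<and> A \<in> max_stable_sets (G \<restriction> closed_nbhd G A)}"

definition greedoid :: "'a set \<Rightarrow> 'a set set \<Rightarrow> bool" where
  "greedoid V F \<longleftrightarrow>
     finite V \<and> F \<noteq> {} \<and> F \<subseteq> Pow V \<and>
     (\<forall>X\<in>F. X \<noteq> {} \<longrightarrow> (\<exists>x\<in>X. X - {x} \<in> F)) \<and>
     (\<forall>X\<in>F. \<forall>Y\<in>F. card X = card Y + 1 \<longrightarrow> (\<exists>x\<in>X - Y. Y \<union> {x} \<in> F))"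

text \<open>
  The cycles of \<open>G\<close> as an undirected graph, each represented by its set of edges \<open>{u, v}\<close>, so that
  traversals differing in starting point or direction give the same cycle. The bound on the length
  excludes the directed cycles \<open>u, v, u\<close> along a single edge. The length of a cycle is the number
  of its edges.
\<close>

definition undirected_cycles :: "('a, 'b) pre_digraph \<Rightarrow> 'a set set set" where
  "undirected_cycles G =
     {(\<lambda>e. {tail G e, head G e}) ` set p | p. pre_digraph.cycle G p \<and> 3 \<le> length p}"

end

theory Submission
  imports Defs
begin

text \<open>
  In every graph, accessibility of the family of local maximum stable sets implies the exchange
  property: build \<open>X\<close> up along an accessible chain and let \<open>x\<close> be the first element that leaves
  \<open>N[Y]\<close>, added to the chain member \<open>Z \<subseteq> N[Y]\<close>. A stable set \<open>S\<close> in \<open>N[Y \<union> {x}]\<close> has at most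
  \<open>|Z| + 1\<close> elements inside \<open>N[Z \<union> {x}]\<close>; the elements outside, together with \<open>Z\<close>, form a stable
  set in \<open>N[Y]\<close>, so there are at most \<open>|Y| - |Z|\<close> of them.

  For accessibility, let \<open>X\<close> be a maximum stable set of \<open>G[V]\<close> with \<open>V = N[X]\<close>, and induct on \<open>V\<close>.
  A vertex \<open>y\<close> of degree at most one in \<open>G[V]\<close> either lies outside \<open>X\<close>, and then its neighbour can
  be removed from \<open>X\<close>; or it is isolated, and then \<open>y\<close> can be removed; or it lies in \<open>X\<close> and has a
  neighbour \<open>z\<close>, and then one passes to \<open>V - {y, z}\<close>. If all degrees are at least two, both ends of
  a longest path close up to the triangle, so \<open>V\<close> is the triangle and \<open>X\<close> a single vertex.
\<close>

section \<open>Longest paths when all degrees are at least two\<close>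

text \<open>The first three and the last three vertices of a longest path both form
  \<open>T\<close>, so the path has only three vertices. Then every \<open>v\<close> is the middle
  of a longest path and lies in \<open>T\<close>.\<close>

lemma min_degree_two_subset_triangle:
  assumes "symp R" "irreflp R" "finite V"
    and deg: "\<And>v. v \<in> V \<Longrightarrow> \<exists>x\<in>V. \<exists>y\<in>V. x \<noteq> y \<and> R v x \<and> R v y"
    and cyc: "\<And>vs. distinct vs \<Longrightarrow> 3 \<le> length vs \<Longrightarrow> successively R vs \<Longrightarrow> R (last vs) (hd vs)
      \<Longrightarrow> length vs = 3 \<and> set vs = T"
  shows "V \<subseteq> T"
proof
  fix v assume "v \<in> V"
  define path where "path p \<longleftrightarrow> distinct p \<and> set p \<subseteq> V \<and> successively R p" for p
  have sym: "R a b \<longleftrightarrow> R b a" for a b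
    using \<open>symp R\<close> by (auto dest: sympD)
  have irrefl: "\<not> R a a" for a
    using \<open>irreflp R\<close> by (auto dest: irreflpD)
  have rev_path: "path (rev p) \<longleftrightarrow> path p" for p
    unfolding path_def using sym by simp
  obtain x y where xy: "x \<in> V" "y \<in> V" "x \<noteq> y" "R v x" "R v y"
    using deg[OF \<open>v \<in> V\<close>] by blast
  have path3: "path [x, v, y]"
    unfolding path_def using xy sym irrefl \<open>v \<in> V\<close> by auto
  have bound: "length p \<le> card V" if "path p" for p
    using that \<open>finite V\<close> unfolding path_def by (metis card_mono distinct_card)
  obtain p where p: "path p" and max: "\<And>q. path q \<Longrightarrow> length q \<le> length p"
    using ex_has_greatest_nat[of path "[x, v, y]" length "Suc (card V)"] path3 bound
    by (metis less_Suc_eq_le)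
  \<comment> \<open>Needed for every path of maximal length: it is applied to \<open>p\<close>, to
    \<open>rev p\<close> and finally to \<open>[x, v, y]\<close>.\<close>
  have start: "\<exists>a b c r. q = a # b # c # r \<and> {a, b, c} = T" if "path q" "length q = length p" for q
  proof -
    have "3 \<le> length q"
      using max[OF path3] that by simp
    then obtain a b r where q: "q = a # b # r"
      by (metis Suc_le_length_iff numeral_3_eq_3)
    have "a \<in> V"
      using that q unfolding path_def by auto
    then obtain w where w: "w \<in> V" "w \<noteq> b" "R a w"
      using deg by metis
    have "w \<in> set q"
    proof (rule ccontr)
      assume "w \<notin> set q"
      then have "path (w # q)"
        using that w sym q unfolding path_def by auto
      then show False
        using max that by fastforce
    qed
    moreover have "w \<noteq> a"
      using w irrefl by blast
    ultimately have "w \<in> set r"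
      using q w by auto
    then obtain r1 r2 where r: "r = r1 @ w # r2"
      by (meson split_list)
    \<comment> \<open>The segment from \<open>a\<close> to \<open>w\<close> closes up through the
      edge between \<open>w\<close> and \<open>a\<close>; its length 3 forces
      \<open>r1 = []\<close>.\<close>
    let ?vs = "a # b # r1 @ [w]"
    have "successively R (?vs @ r2)"
      using that q r unfolding path_def by simp
    then have "successively R ?vs"
      by (simp only: successively_append_iff)
    moreover have "distinct ?vs"
      using that q r unfolding path_def by auto
    ultimately have "length ?vs = 3 \<and> set ?vs = T"
      using w sym by (intro cyc) auto
    then show ?thesis
      using q r by auto
  qed
  obtain a b c r where p1: "p = a # b # c # r" "{a, b, c} = T"
    using start p by blast
  obtain a' b' c' r' where p2: "rev p = a' # b' # c' # r'" "{a', b', c'} = T"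
    using start[of "rev p"] p rev_path by auto
  have p3: "p = rev r' @ [c', b', a']"
    using p2 by (metis append.assoc append_Cons append_Nil rev.simps(2) rev_rev_ident)
  \<comment> \<open>Otherwise the first vertex \<open>a\<close> of \<open>p\<close> would occur a
    second time among the last three, which also form \<open>T\<close>.\<close>
  have "r' = []"
  proof (rule ccontr)
    assume "r' \<noteq> []"
    then have "a \<in> set r'"
      using p1 p3 by (metis hd_append2 hd_in_set list.sel(1) rev_is_Nil_conv set_rev)
    moreover have "a \<in> {a', b', c'}"
      using p1 p2 by blast
    moreover have "distinct p"
      using p unfolding path_def by blast
    ultimately show False
      using p3 by auto
  qed
  then have "length p = 3"
    using p3 by simp
  then show "v \<in> T"
    using start[OF path3] by auto
qed

section \<open>Removing a vertex from a maximum stable set\<close>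

text \<open>An arbitrary \<open>V\<close> replaces N[X] because the induction deletes two vertices,
  and \<open>V - {y, z}\<close> need not be the closed neighbourhood of \<open>X - {y}\<close>. The
  condition \<open>cyc\<close> does not mention \<open>V\<close> and so survives the
  deletion.\<close>

lemma max_stable_accessible:
  assumes "symp R" "irreflp R" "finite V" "finite T" "card T \<le> 3"
    and cyc: "\<And>vs. distinct vs \<Longrightarrow> 3 \<le> length vs \<Longrightarrow> successively R vs \<Longrightarrow> R (last vs) (hd vs)
      \<Longrightarrow> length vs = 3 \<and> set vs = T"
    and "X \<subseteq> V" "X \<noteq> {}" "\<forall>u\<in>X. \<forall>v\<in>X. \<not> R u v"
    and "\<And>S. S \<subseteq> V \<Longrightarrow> \<forall>u\<in>S. \<forall>v\<in>S. \<not> R u v \<Longrightarrow> card S \<le> card X"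
  shows "\<exists>x\<in>X. \<forall>S\<subseteq>V. (\<forall>u\<in>S. \<forall>v\<in>S. \<not> R u v) \<longrightarrow>
      (\<forall>s\<in>S. s \<in> X - {x} \<or> (\<exists>a\<in>X - {x}. R s a)) \<longrightarrow> card S < card X"
  using assms(3,7-)
proof (induction V arbitrary: X rule: finite_psubset_induct)
  case (psubset V)
  have sym: "R a b \<longleftrightarrow> R b a" for a b
    using \<open>symp R\<close> by (auto dest: sympD)
  have irrefl: "\<not> R a a" for a
    using \<open>irreflp R\<close> by (auto dest: irreflpD)
  note XV = psubset.prems(1) and Xne = psubset.prems(2)
    and Xst = psubset.prems(3)[rule_format] and max = psubset.prems(4)
  have finX: "finite X"
    using XV psubset.hyps finite_subset by blast
  have insert_le: "card S < card X"
    if "S \<subseteq> V" "\<forall>u\<in>S. \<forall>v\<in>S. \<not> R u v" "y \<in> V" "y \<notin> S" "\<forall>u\<in>S. \<not> R y u" for S y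
  proof -
    have "card (insert y S) \<le> card X"
      using that sym irrefl by (intro max) auto
    moreover have "finite S"
      using that psubset.hyps finite_subset by blast
    ultimately show ?thesis
      using that by simp
  qed
  show ?case
  proof (cases "\<exists>y\<in>V. \<forall>a\<in>V. \<forall>b\<in>V. R y a \<longrightarrow> R y b \<longrightarrow> a = b")
    case True
    then obtain y where y: "y \<in> V" and leaf: "\<And>a b. \<lbrakk>a \<in> V; b \<in> V; R y a; R y b\<rbrakk> \<Longrightarrow> a = b"
      by blast
    consider (outside) "y \<notin> X" | (isolated) "y \<in> X" "\<forall>a\<in>V. \<not> R y a"
      | (inside) z where "y \<in> X" "z \<in> V" "R y z"
      by blast
    then show ?thesis
    proof cases
      case outside
      \<comment> \<open>Without such a \<open>z\<close>, adding \<open>y\<close> to \<open>X\<close>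
        would contradict maximality.\<close>
      obtain z where z: "z \<in> X" "R y z"
        using insert_le[of X y] XV psubset.prems(3) y outside by blast
      show ?thesis
      proof (intro bexI[OF _ z(1)] allI impI)
        fix S
        assume S: "S \<subseteq> V" "\<forall>u\<in>S. \<forall>v\<in>S. \<not> R u v"
          "\<forall>s\<in>S. s \<in> X - {z} \<or> (\<exists>a\<in>X - {z}. R s a)"
        \<comment> \<open>The only neighbour of \<open>y\<close> in \<open>V\<close> is the removed
          \<open>z\<close>, and \<open>z\<close> has no neighbour in \<open>X\<close>. So
          \<open>S\<close> contains neither, and \<open>y\<close> can be added to it.\<close>
        have "y \<notin> S"
          using S(3) outside leaf z XV by blast
        moreover have "z \<notin> S"
          using S(3) z Xst by blast
        ultimately show "card S < card X"
          using insert_le[OF S(1,2) y] leaf z XV S(1) by blast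
      qed
    next
      case isolated
      show ?thesis
      proof (intro bexI[OF _ isolated(1)] allI impI)
        fix S
        assume S: "S \<subseteq> V" "\<forall>u\<in>S. \<forall>v\<in>S. \<not> R u v"
          "\<forall>s\<in>S. s \<in> X - {y} \<or> (\<exists>a\<in>X - {y}. R s a)"
        have "y \<notin> S"
          using S(3) isolated XV by blast
        then show "card S < card X"
          using insert_le[OF S(1,2) y] isolated S(1) by blast
      qed
    next
      case inside
      have "z \<notin> X"
        using inside Xst by blast
      have nbr: "a = z" if "a \<in> V" "R y a" for a
        using leaf that inside by blast
      have cardX: "card X = Suc (card (X - {y}))"
        using card.remove[OF finX inside(1)] .
      show ?thesis
      proof (cases "X = {y}")
        case True
        then show ?thesis by auto
      next
        case False
        have "\<exists>x\<in>X - {y}. \<forall>S\<subseteq>V - {y, z}. (\<forall>u\<in>S. \<forall>v\<in>S. \<not> R u v) \<longrightarrow>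
          (\<forall>s\<in>S. s \<in> X - {y} - {x} \<or> (\<exists>a\<in>X - {y} - {x}. R s a)) \<longrightarrow> card S < card (X - {y})"
        proof (rule psubset.IH)
          show "V - {y, z} \<subset> V"
            using y by blast
          show "X - {y} \<subseteq> V - {y, z}"
            using XV \<open>z \<notin> X\<close> by blast
          show "X - {y} \<noteq> {}"
            using False Xne by blast
          show "\<forall>u\<in>X - {y}. \<forall>v\<in>X - {y}. \<not> R u v"
            using Xst by blast
          show "card S \<le> card (X - {y})"
            if "S \<subseteq> V - {y, z}" "\<forall>u\<in>S. \<forall>v\<in>S. \<not> R u v" for S
          proof -
            \<comment> \<open>With \<open>z\<close> deleted, \<open>y\<close> extends every stable
              set of the smaller vertex set, so maximality passes to \<open>X - {y}\<close>.\<close>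
            have "y \<notin> S" "\<forall>u\<in>S. \<not> R y u"
              using that(1) nbr by auto
            then have "card S < card X"
              using that y by (intro insert_le[of S y]) auto
            then show ?thesis
              using cardX by simp
          qed
        qed
        then obtain x where x: "x \<in> X - {y}" and less: "\<And>S. \<lbrakk>S \<subseteq> V - {y, z}; \<forall>u\<in>S. \<forall>v\<in>S. \<not> R u v;
            \<forall>s\<in>S. s \<in> X - {y} - {x} \<or> (\<exists>a\<in>X - {y} - {x}. R s a)\<rbrakk> \<Longrightarrow> card S < card (X - {y})"
          by blast
        show ?thesis
        proof (intro bexI[of _ x] allI impI)
          show "x \<in> X"
            using x by blast
          fix S
          assume S: "S \<subseteq> V" "\<forall>u\<in>S. \<forall>v\<in>S. \<not> R u v"
            "\<forall>s\<in>S. s \<in> X - {x} \<or> (\<exists>a\<in>X - {x}. R s a)"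
          have "finite S"
            using S psubset.hyps finite_subset by blast
          \<comment> \<open>In \<open>V\<close>, \<open>y\<close> is adjacent only to
            \<open>z\<close>, so every vertex of \<open>S - {y, z}\<close> is covered by
            \<open>X - {x}\<close> without the help of \<open>y\<close>.\<close>
          have "card (S - {y, z}) < card (X - {y})"
          proof (rule less)
            show "\<forall>s\<in>S - {y, z}. s \<in> X - {y} - {x} \<or> (\<exists>a\<in>X - {y} - {x}. R s a)"
              using S(1,3) nbr sym by blast
          qed (use S in auto)
          moreover have "card S \<le> Suc (card (S - {y, z}))"
          proof -
            have "S \<subseteq> insert y (S - {y, z}) \<or> S \<subseteq> insert z (S - {y, z})"
              using S(2) inside by blast
            then show ?thesis
              using \<open>finite S\<close>
              by (metis card_insert_le_m1 card_mono card_insert_disjoint finite_Diff finite_insert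
                  Diff_iff insertCI)
          qed
          ultimately show "card S < card X"
            using cardX by linarith
        qed
      qed
    qed
  next
    case False
    then have deg: "\<exists>x\<in>V. \<exists>y\<in>V. x \<noteq> y \<and> R v x \<and> R v y" if "v \<in> V" for v
      using that by blast
    have "V \<subseteq> T"
      using min_degree_two_subset_triangle[OF assms(1,2) psubset.hyps deg cyc] by blast
    obtain x where x: "x \<in> X"
      using Xne by blast
    \<comment> \<open>A second element of \<open>X\<close>, together with \<open>x\<close> and two
      neighbours of \<open>x\<close>, would give four vertices in \<open>T\<close>.\<close>
    have "x' = x" if "x' \<in> X" for x'
    proof (rule ccontr)
      assume "x' \<noteq> x"
      obtain a b where ab: "a \<in> V" "b \<in> V" "a \<noteq> b" "R x a" "R x b"
        using deg x XV by blast
      have "a \<noteq> x" "b \<noteq> x" "a \<noteq> x'" "b \<noteq> x'"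
        using ab irrefl Xst[OF x that] by auto
      then have "card {x, x', a, b} = 4"
        using ab(3) \<open>x' \<noteq> x\<close> by simp
      moreover have "card {x, x', a, b} \<le> card T"
        using ab x that XV \<open>V \<subseteq> T\<close> \<open>finite T\<close> by (intro card_mono) auto
      ultimately show False
        using \<open>card T \<le> 3\<close> by simp
    qed
    then have "X = {x}"
      using x by blast
    then show ?thesis by auto
  qed
qed

section \<open>Local maximum stable sets without induced subgraphs\<close>

lemma closed_nbhd_subset_verts: "A \<subseteq> verts G \<Longrightarrow> closed_nbhd G A \<subseteq> verts G"
  unfolding closed_nbhd_def open_nbhd_def by blast

lemma stable_set_induce_subgraph_iff:
  assumes "U \<subseteq> verts G"
  shows "stable_set (G \<restriction> U) S \<longleftrightarrow> stable_set G S \<and> S \<subseteq> U"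
proof -
  have "u \<rightarrow>\<^bsub>G \<restriction> U\<^esub> v \<longleftrightarrow> u \<rightarrow>\<^bsub>G\<^esub> v" if "u \<in> U" "v \<in> U" for u v
    using that unfolding arcs_ends_conv by auto
  then show ?thesis
    using assms unfolding stable_set_def induce_subgraph_verts by (meson subsetD subset_trans)
qed

lemma local_max_stable_sets_iff:
  "A \<in> local_max_stable_sets G \<longleftrightarrow> stable_set G A \<and>
     (\<forall>S. stable_set G S \<longrightarrow> S \<subseteq> closed_nbhd G A \<longrightarrow> card S \<le> card A)"
proof (cases "A \<subseteq> verts G")
  case True
  then have "stable_set (G \<restriction> closed_nbhd G A) S \<longleftrightarrow> stable_set G S \<and> S \<subseteq> closed_nbhd G A" for S
    by (intro stable_set_induce_subgraph_iff closed_nbhd_subset_verts)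
  moreover have "A \<subseteq> closed_nbhd G A"
    unfolding closed_nbhd_def by blast
  ultimately show ?thesis
    using True unfolding local_max_stable_sets_def max_stable_sets_def by (simp add: imp_conjL)
next
  case False
  then show ?thesis
    unfolding local_max_stable_sets_def stable_set_def by simp
qed

lemma closed_nbhd_iff:
  "v \<in> closed_nbhd G A \<longleftrightarrow> v \<in> A \<or> v \<in> verts G \<and> (\<exists>a\<in>A. v \<rightarrow>\<^bsub>G\<^esub> a)"
  unfolding closed_nbhd_def open_nbhd_def by blast

section \<open>Exchange from accessibility\<close>

text \<open>Peel elements off \<open>X\<close> inside \<open>F\<close> until the remainder first
  lies in \<open>N\<close>; the element removed last is then outside \<open>N\<close>.\<close>

lemma accessible_chain_leaves_set:
  assumes acc: "\<And>X. X \<in> F \<Longrightarrow> X \<noteq> {} \<Longrightarrow> \<exists>x\<in>X. X - {x} \<in> F"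
    and "finite X" "X \<in> F" "\<not> X \<subseteq> N"
  shows "\<exists>Z x. Z \<in> F \<and> x \<in> X \<and> x \<notin> N \<and> Z \<subseteq> N \<and> insert x Z \<in> F"
  using assms(2-)
proof (induction X rule: finite_psubset_induct)
  case (psubset X)
  obtain x where x: "x \<in> X" "X - {x} \<in> F"
    using acc psubset.prems by blast
  show ?case
  proof (cases "X - {x} \<subseteq> N")
    case True
    then show ?thesis
      using x psubset.prems by (metis insert_Diff insert_subset)
  next
    case False
    then show ?thesis
      using psubset.IH[of "X - {x}"] x by blast
  qed
qed

lemma (in graph) exchange_if_accessible:
  assumes acc: "\<And>X. X \<in> local_max_stable_sets G \<Longrightarrow> X \<noteq> {} \<Longrightarrow>
      \<exists>x\<in>X. X - {x} \<in> local_max_stable_sets G"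
    and X: "X \<in> local_max_stable_sets G" and Y: "Y \<in> local_max_stable_sets G"
    and "card Y < card X"
  shows "\<exists>x\<in>X - Y. Y \<union> {x} \<in> local_max_stable_sets G"
proof -
  have stable_finite: "finite S" if "stable_set G S" for S
    using that finite_verts finite_subset unfolding stable_set_def by blast
  note iff = local_max_stable_sets_iff
  have Ymax: "card S \<le> card Y" if "stable_set G S" "S \<subseteq> closed_nbhd G Y" for S
    using that Y unfolding iff by blast
  have "\<not> X \<subseteq> closed_nbhd G Y"
    using X Ymax \<open>card Y < card X\<close> unfolding iff by (meson not_le)
  moreover have "finite X"
    using X stable_finite unfolding iff by blast
  ultimately obtain Z x where Z: "Z \<in> local_max_stable_sets G" "Z \<subseteq> closed_nbhd G Y"
      "insert x Z \<in> local_max_stable_sets G" and x: "x \<in> X" "x \<notin> closed_nbhd G Y"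
    using accessible_chain_leaves_set[OF acc] X by metis
  have sym: "a \<rightarrow>\<^bsub>G\<^esub> b \<longleftrightarrow> b \<rightarrow>\<^bsub>G\<^esub> a" for a b
    using arcs_ends_symmetric[OF sym_arcs] by blast
  have "x \<in> verts G"
    using x X unfolding iff stable_set_def by blast
  have xZ: "stable_set G (insert x Z)"
    using Z unfolding iff by blast
  have Yst: "stable_set G Y"
    using Y unfolding iff by blast
  have "x \<notin> Y" and xY: "\<And>a. a \<in> Y \<Longrightarrow> \<not> x \<rightarrow>\<^bsub>G\<^esub> a"
    using x \<open>x \<in> verts G\<close> unfolding closed_nbhd_iff by auto
  then have "stable_set G (insert x Y)"
    using Yst xZ sym unfolding stable_set_def by auto
  moreover have "card S \<le> card (insert x Y)"
    if S: "stable_set G S" "S \<subseteq> closed_nbhd G (insert x Y)" for S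
  proof -
    let ?A = "S \<inter> closed_nbhd G (insert x Z)" and ?B = "S - closed_nbhd G (insert x Z)"
    have "stable_set G ?A"
      using S unfolding stable_set_def by blast
    then have A: "card ?A \<le> card (insert x Z)"
      using Z(3) unfolding iff by blast
    have "\<not> u \<rightarrow>\<^bsub>G\<^esub> z" "\<not> z \<rightarrow>\<^bsub>G\<^esub> u" if "u \<in> ?B" "z \<in> Z" for u z
      using that S(1) sym[of u z] by (auto simp: stable_set_def closed_nbhd_iff)
    then have "stable_set G (?B \<union> Z)"
      using S(1) xZ unfolding stable_set_def by auto
    \<comment> \<open>Elements of \<open>?B\<close> lie in N[Y + x] but are neither equal nor
      adjacent to \<open>x\<close>, so \<open>Y\<close> alone accounts for them.\<close>
    moreover have "?B \<union> Z \<subseteq> closed_nbhd G Y"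
      using S(2) Z(2) by (auto simp: closed_nbhd_iff subset_iff)
    ultimately have "card (?B \<union> Z) \<le> card Y"
      by (rule Ymax)
    moreover have "card (?B \<union> Z) = card ?B + card Z"
      using stable_finite[OF S(1)] stable_finite[OF xZ]
      by (intro card_Un_disjoint) (auto simp: closed_nbhd_iff)
    moreover have "card S = card ?A + card ?B"
      using stable_finite[OF S(1)] by (metis card_Int_Diff)
    moreover have "card (insert x Z) = Suc (card Z)"
      using x(2) Z(2) stable_finite[OF xZ] by (subst card_insert_disjoint) auto
    moreover have "card (insert x Y) = Suc (card Y)"
      using \<open>x \<notin> Y\<close> stable_finite[OF Yst] by simp
    ultimately show ?thesis
      using A by linarith
  qed
  ultimately have "insert x Y \<in> local_max_stable_sets G"
    unfolding iff by blast
  then show ?thesis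
    using x \<open>x \<notin> Y\<close> by auto
qed

section \<open>Cycles as vertex lists and as edge sets\<close>

text \<open>Matches the edge sets in \<open>undirected_cycles\<close>. There is no closing edge, so
  a cycle through \<open>vs\<close> is written \<open>vs @ [hd vs]\<close>.\<close>

fun path_edges :: "'a list \<Rightarrow> 'a set set" where
  "path_edges (u # v # vs) = insert {u, v} (path_edges (v # vs))"
| "path_edges vs = {}"

lemma Union_path_edges: "2 \<le> length vs \<Longrightarrow> \<Union> (path_edges vs) = set vs"
proof (induction vs rule: path_edges.induct)
  case (1 u v vs)
  then show ?case
    by (cases vs) auto
qed auto

lemma finite_path_edges: "finite (path_edges vs)"
  by (induction vs rule: path_edges.induct) auto

lemma last_edge_in_path_edges: "vs \<noteq> [] \<Longrightarrow> {last vs, w} \<in> path_edges (vs @ [w])"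
  by (induction vs rule: path_edges.induct) auto

lemma (in wf_digraph) awalk_of_successive:
  assumes "successively (dominates G) (u # vs)" "u \<in> verts G"
  shows "\<exists>p. awalk u p (last (u # vs)) \<and> awalk_verts u p = u # vs \<and>
    (\<lambda>e. {tail G e, head G e}) ` set p = path_edges (u # vs)"
  using assms
proof (induction vs arbitrary: u)
  case Nil
  then show ?case
    by (intro exI[of _ "[]"]) (auto simp: awalk_simps)
next
  case (Cons v vs)
  obtain e where e: "e \<in> arcs G" "tail G e = u" "head G e = v"
    using Cons.prems by (auto simp: arcs_ends_conv)
  moreover obtain p where "awalk v p (last (v # vs))" "awalk_verts v p = v # vs"
      "(\<lambda>e. {tail G e, head G e}) ` set p = path_edges (v # vs)"
    using Cons.IH[of v] Cons.prems e by auto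
  ultimately show ?case
    by (intro exI[of _ "e # p"]) (auto simp: awalk_simps)
qed

lemma (in wf_digraph) path_edges_in_undirected_cycles:
  assumes "distinct vs" "3 \<le> length vs" "successively (dominates G) vs" "last vs \<rightarrow>\<^bsub>G\<^esub> hd vs"
  shows "path_edges (vs @ [hd vs]) \<in> undirected_cycles G"
proof -
  obtain u ws where vs: "vs = u # ws"
    using assms(2) by (cases vs) auto
  have "u \<in> verts G"
    using assms(4) vs by (auto dest: adj_in_verts)
  moreover have "successively (dominates G) (u # ws @ [u])"
    using assms(3,4) vs successively_append_iff[of "dominates G" vs "[u]"] by auto
  ultimately obtain p where p: "awalk u p u" "awalk_verts u p = u # ws @ [u]"
      "(\<lambda>e. {tail G e, head G e}) ` set p = path_edges (u # ws @ [u])"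
    using awalk_of_successive[of u "ws @ [u]"] by auto
  have "length p = length vs"
    using length_awalk_verts[of u p] p(2) vs by simp
  \<comment> \<open>Dropping the first vertex of the closed walk leaves \<open>ws @ [u]\<close>, a
    rearrangement of the distinct list \<open>vs\<close>.\<close>
  moreover have "cycle p"
    unfolding cycle_def using p assms(1,2) vs calculation by auto
  ultimately show ?thesis
    unfolding undirected_cycles_def mem_Collect_eq using p(3) assms(2) vs
    by (intro exI[of _ p]) simp
qed

lemma card_three_cycle_edges:
  assumes "distinct vs" "3 \<le> length vs" "card (path_edges (vs @ [hd vs])) = 3"
  shows "length vs = 3"
proof (rule ccontr)
  assume "length vs \<noteq> 3"
  then have "Suc (Suc (Suc (Suc 0))) \<le> length vs"
    using assms(2) by simp
  then obtain a b c d ws where vs: "vs = a # b # c # d # ws"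
    by (metis Suc_le_length_iff)
  \<comment> \<open>For a list of exactly four vertices \<open>?z\<close> is \<open>d\<close>, so
    the closing edge is covered uniformly and is always a fourth edge.\<close>
  let ?z = "last (d # ws)"
  have "?z \<in> set (d # ws)"
    by (rule last_in_set) simp
  then have "card {{a, b}, {b, c}, {c, d}, {?z, a}} = 4"
    using assms(1) vs by (auto simp: card_insert_if doubleton_eq_iff)
  moreover have "{{a, b}, {b, c}, {c, d}, {?z, a}} \<subseteq> path_edges (vs @ [hd vs])"
    using last_edge_in_path_edges[of "d # ws" a] vs by auto
  ultimately have "4 \<le> card (path_edges (vs @ [hd vs]))"
    using card_mono[OF finite_path_edges] by metis
  then show False
    using assms(3) by simp
qed

section \<open>Graphs whose only cycle is a triangle\<close>

lemma (in graph) accessible_if_unique_cycle_triangle: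
  assumes C: "undirected_cycles G = {C}" "card C = 3"
    and X: "X \<in> local_max_stable_sets G" "X \<noteq> {}"
  shows "\<exists>x\<in>X. X - {x} \<in> local_max_stable_sets G"
proof -
  have cyc: "length vs = 3 \<and> set vs = \<Union> C"
    if "distinct vs" "3 \<le> length vs" "successively (dominates G) vs" "last vs \<rightarrow>\<^bsub>G\<^esub> hd vs" for vs
  proof -
    have "path_edges (vs @ [hd vs]) = C"
      using path_edges_in_undirected_cycles[OF that] C(1) by blast
    moreover have "hd vs \<in> set vs"
      using that by (intro hd_in_set) auto
    ultimately show ?thesis
      using card_three_cycle_edges[OF that(1,2)] C(2) Union_path_edges[of "vs @ [hd vs]"] that(2)
      by auto
  qed
  \<comment> \<open>If some list of length three has vertex set \<open>\<Union> C\<close>, that set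
    is small and serves as \<open>T\<close>. Otherwise \<open>cyc\<close> shows that no closed
    vertex list exists, and \<open>{}\<close> serves; no vertex list has to be extracted from
    \<open>C\<close>.\<close>
  obtain T where T: "finite T" "card T \<le> 3" and cycT: "\<And>vs. \<lbrakk>distinct vs; 3 \<le> length vs;
      successively (dominates G) vs; last vs \<rightarrow>\<^bsub>G\<^esub> hd vs\<rbrakk> \<Longrightarrow> length vs = 3 \<and> set vs = T"
  proof (cases "\<exists>vs. length vs = 3 \<and> set vs = \<Union> C")
    case True
    then have "finite (\<Union> C)" "card (\<Union> C) \<le> 3"
      by (metis List.finite_set) (metis True card_length)
    then show ?thesis
      using that cyc by blast
  next
    case False
    then show ?thesis
      using that[of "{}"] cyc by auto
  qed
  have sym: "symp (dominates G)"
    using arcs_ends_symmetric[OF sym_arcs] by (auto intro: sympI)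
  have irrefl: "irreflp (dominates G)"
    using adj_not_same by (auto intro: irreflpI)
  have Xst: "stable_set G X"
    and max: "\<And>S. stable_set G S \<Longrightarrow> S \<subseteq> closed_nbhd G X \<Longrightarrow> card S \<le> card X"
    using X unfolding local_max_stable_sets_iff by auto
  have VG: "closed_nbhd G X \<subseteq> verts G"
    using Xst closed_nbhd_subset_verts unfolding stable_set_def by blast
  have "\<exists>x\<in>X. \<forall>S\<subseteq>closed_nbhd G X. (\<forall>u\<in>S. \<forall>v\<in>S. \<not> u \<rightarrow>\<^bsub>G\<^esub> v) \<longrightarrow>
      (\<forall>s\<in>S. s \<in> X - {x} \<or> (\<exists>a\<in>X - {x}. s \<rightarrow>\<^bsub>G\<^esub> a)) \<longrightarrow> card S < card X"
  proof (rule max_stable_accessible[OF sym irrefl _ T cycT])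
    show "finite (closed_nbhd G X)"
      using VG finite_verts by (rule finite_subset)
    show "X \<subseteq> closed_nbhd G X"
      unfolding closed_nbhd_def by blast
    show "\<forall>u\<in>X. \<forall>v\<in>X. \<not> u \<rightarrow>\<^bsub>G\<^esub> v"
      using Xst unfolding stable_set_def by blast
    show "card S \<le> card X"
      if "S \<subseteq> closed_nbhd G X" "\<forall>u\<in>S. \<forall>v\<in>S. \<not> u \<rightarrow>\<^bsub>G\<^esub> v" for S
      using that VG by (intro max) (auto simp: stable_set_def)
  qed (use X in auto)
  then obtain x where x: "x \<in> X" and less: "\<And>S. \<lbrakk>S \<subseteq> closed_nbhd G X; \<forall>u\<in>S. \<forall>v\<in>S. \<not> u \<rightarrow>\<^bsub>G\<^esub> v;
      \<forall>s\<in>S. s \<in> X - {x} \<or> (\<exists>a\<in>X - {x}. s \<rightarrow>\<^bsub>G\<^esub> a)\<rbrakk> \<Longrightarrow> card S < card X"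
    by blast
  \<comment> \<open>Since N[X - x] is contained in N[X], the bound obtained for stable sets inside
    N[X] applies.\<close>
  have "card S \<le> card (X - {x})" if S: "stable_set G S" "S \<subseteq> closed_nbhd G (X - {x})" for S
  proof -
    have "card S < card X"
    proof (rule less)
      show "S \<subseteq> closed_nbhd G X"
        using S(2) by (auto simp: closed_nbhd_iff subset_iff)
      show "\<forall>s\<in>S. s \<in> X - {x} \<or> (\<exists>a\<in>X - {x}. s \<rightarrow>\<^bsub>G\<^esub> a)"
        using S(2) by (auto simp: closed_nbhd_iff subset_iff)
    qed (use S in \<open>auto simp: stable_set_def\<close>)
    then show ?thesis
      using x by simp
  qed
  moreover have "stable_set G (X - {x})"
    using Xst unfolding stable_set_def by blast
  ultimately show ?thesis
    using x unfolding local_max_stable_sets_iff by blast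
qed

theorem theorem2p3:
  fixes G :: "('a, 'b) pre_digraph"
  assumes "graph G"
    and "\<exists>C. undirected_cycles G = {C} \<and> card C = 3"
  shows "greedoid (verts G) (local_max_stable_sets G)"
proof -
  interpret graph G by fact
  have acc: "\<exists>x\<in>X. X - {x} \<in> local_max_stable_sets G"
    if "X \<in> local_max_stable_sets G" "X \<noteq> {}" for X
    using accessible_if_unique_cycle_triangle that assms(2) by blast
  have "{} \<in> local_max_stable_sets G"
    unfolding local_max_stable_sets_iff
    by (auto simp: stable_set_def closed_nbhd_def open_nbhd_def)
  moreover have "local_max_stable_sets G \<subseteq> Pow (verts G)"
    unfolding local_max_stable_sets_def by blast
  ultimately show ?thesis
    unfolding greedoid_def using acc exchange_if_accessible[OF acc] by auto
qed

end
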